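(* Let $n\ge 2$, let $\alpha_1,\dots,\alpha_n>0$ be pairwise distinct, let $c>0$, let $X_1,\dots,X_n$ be independent with $X_i\sim \mathrm{Exp}(\alpha_i)$, and set $k_i=-c\ln\alpha_i$, $\lambda=c$ and $Y_i=c\ln X_i$. Then $Y_i\sim \mathrm{Gumbel}(k_i,\lambda)$, with domain $\mathbb{R}$, for each $i$, and the Mixed Hypoexponential Gumbel distribution $Z\sim MHG(k_1,\dots,k_n,\lambda)$, i.e. the mixed T-G distribution generated from the hypoexponential distribution with parameters $(\alpha_1,\dots,\alpha_n)$ and the transformation $x\mapsto c\ln x$, has PDF $$f_Z(t)=\sum_{i=1}^n\frac{1}{PG_i}f_{Y_i}(t),\qquad PG_i=\prod_{j=1,\,j\ne i}^{n}\left(1-e^{\frac{-k_i+k_j}{\lambda}}\right).$$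
   Context: $\mathrm{Exp}(\alpha)$ has density $\alpha e^{-\alpha t}$ for $t>0$. The hypoexponential distribution with pairwise distinct parameters $\alpha_1,\dots,\alpha_n>0$ is the law of $T=\sum_{i=1}^nX_i$ with $X_i\sim\mathrm{Exp}(\alpha_i)$ independent; its density is $f_{T}(t)=\sum_{i=1}^n\frac{f_{X_i}(t)}{P_i}$, $t>0$, where $P_i=\prod_{j\ne i}\left(1-\frac{\alpha_i}{\alpha_j}\right)$ (known fact). If a distribution $T$ has density $\sum_iA_if_{X_i}$ with $A_i\in\mathbb{R}$, $\sum_iA_i=1$, and $g$ is a one-to-one function, the mixed T-G distribution generated from $T$ and $g$ is the distribution with density $\sum_iA_if_{g(X_i)}$. In this convention $\mathrm{Gumbel}(k,\lambda)$ with location $k\in\mathbb{R}$ and scale $\lambda>0$ has density $\frac1\lambda \exp\left(\frac{t-k}{\lambda}-e^{\frac{t-k}{\lambda}}\right)$, $t\in\mathbb{R}$. *)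

theory Defs
  imports "HOL-Probability.Probability"
begin

(* The real-valued f is a probability density function of the law N.  The sign condition is
   explicit because the mixtures below may have negative coefficients, and the coercion to
   ennreal would silently truncate negative values to 0. *)
definition has_pdf :: "real measure \<Rightarrow> (real \<Rightarrow> real) \<Rightarrow> bool" where
  "has_pdf N f \<longleftrightarrow>
     prob_space N \<and> f \<in> borel_measurable borel \<and> (AE t in lborel. 0 \<le> f t) \<and>
     N = density lborel (\<lambda>t. ennreal (f t))"

(* The orientation with density exp (u - exp u), i.e. the Gumbel law for minima. *)
definition gumbel_density :: "real \<Rightarrow> real \<Rightarrow> real \<Rightarrow> real" where
  "gumbel_density k lam t = 1 / lam * exp ((t - k) / lam - exp ((t - k) / lam))"

(* N is the mixed T-G distribution generated from T and g: T has density
   sum A_i f_{X_i} and N has density sum A_i f_{g(X_i)}, where F i is the law of X_i.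
   As g is a total function in HOL (e.g. ln), it is required to be one-to-one only on a
   set S that carries all the X_i. *)
definition mixed_TG_distribution ::
  "'i set \<Rightarrow> ('i \<Rightarrow> real measure) \<Rightarrow> real measure \<Rightarrow> real set \<Rightarrow> (real \<Rightarrow> real) \<Rightarrow> real measure \<Rightarrow> bool"
where
  "mixed_TG_distribution I F T S g N \<longleftrightarrow>
     finite I \<and> g \<in> borel_measurable borel \<and> inj_on g S \<and> (\<forall>i\<in>I. AE x in F i. x \<in> S) \<and>
     (\<exists>A f h. (\<Sum>i\<in>I. A i) = 1 \<and>
        (\<forall>i\<in>I. has_pdf (F i) (f i) \<and> has_pdf (distr (F i) borel g) (h i)) \<and>
        has_pdf T (\<lambda>t. \<Sum>i\<in>I. A i * f i t) \<and>
        has_pdf N (\<lambda>t. \<Sum>i\<in>I. A i * h i t))"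

definition PG :: "nat \<Rightarrow> (nat \<Rightarrow> real) \<Rightarrow> real \<Rightarrow> nat \<Rightarrow> real" where
  "PG n k lam i = (\<Prod>j\<in>{1..n} - {i}. 1 - exp ((- k i + k j) / lam))"

end

theory Submission
  imports Defs "HOL-Real_Asymp.Real_Asymp"
begin

text \<open>Integrating over preimages under \<open>g\<close> shows that a mixed T-G distribution is nothing but the law
  of \<open>g(T)\<close>: both give a set \<open>B\<close> the mass \<open>\<Sum>i. A i * P (g (X i) \<in> B)\<close>. It is therefore unique,
  whatever densities and coefficients represent it, and any one representation of the hypoexponential
  density yields its density. That representation is obtained by convolving one exponential
  density at a time; the coefficient of the new exponential is a partial fraction sum. Finally,
  \<open>k i = - c * ln (\<alpha> i)\<close> turns \<open>\<alpha> i / \<alpha> j\<close> into \<open>exp ((- k i + k j) / c)\<close>.\<close>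

section \<open>Partial fractions and the convolution of two exponential densities\<close>

text \<open>For nonempty \<open>I\<close> the right side is a rational function of \<open>b\<close>
  with simple poles at the distinct \<open>a i\<close>, and the left side is its partial fraction
  expansion. The induction keeps \<open>b\<close> arbitrary because its hypothesis is used at two
  points, at \<open>b\<close> and at the new parameter \<open>a g\<close>. The empty set is
  separate: an empty sum is 0, but an empty product is 1.\<close>

lemma hypoexponential_partial_fraction:
  fixes a :: "'i \<Rightarrow> real"
  assumes "finite I" "\<And>i. i \<in> I \<Longrightarrow> a i > 0" "inj_on a I" "b > 0" "b \<notin> a ` I"
  shows "(\<Sum>i\<in>I. (1 / (\<Prod>j\<in>I-{i}. 1 - a i / a j)) / (1 - b / a i)) =
    (if I = {} then 0 else 1 / (\<Prod>i\<in>I. 1 - b / a i))"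
  using assms
proof (induction I arbitrary: b rule: finite_induct)
  case empty
  then show ?case by simp
next
  case (insert g I)
  show ?case
  proof (cases "I = {}")
    case True
    then show ?thesis by simp
  next
    case False
    let ?P = "\<lambda>i. \<Prod>j\<in>I-{i}. 1 - a i / a j"
    have pos: "a g > 0" "b > 0" "\<And>i. i \<in> I \<Longrightarrow> a i > 0"
      using insert.prems by auto
    have ne: "b \<noteq> a g" "\<And>i. i \<in> I \<Longrightarrow> a i \<noteq> a g" "\<And>i. i \<in> I \<Longrightarrow> a i \<noteq> b"
      using insert.prems insert.hyps by (auto simp: inj_on_def)
    have IH: "(\<Sum>i\<in>I. (1 / ?P i) / (1 - c / a i)) = 1 / (\<Prod>i\<in>I. 1 - c / a i)"
      if "c > 0" "c \<notin> a ` I" for c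
      using insert.IH[of c] insert.prems that False by auto
    have 1: "(\<Prod>j\<in>insert g I - {i}. 1 - a i / a j) = (1 - a i / a g) * ?P i" if "i \<in> I" for i
    proof -
      have "insert g I - {i} = insert g (I - {i})" using that insert.hyps by auto
      then show ?thesis using insert.hyps by simp
    qed
    have 2: "insert g I - {g} = I" using insert.hyps by auto
    \<comment> \<open>This is the expansion for two parameters \<open>x\<close> and
      \<open>y\<close>; below it is applied to each pair \<open>a i\<close>,
      \<open>a g\<close>.\<close>
    have key: "1 / (1 - x / y) * (1 / (1 - b / x)) + 1 / (1 - y / x) * (1 / (1 - b / y))
        = 1 / (1 - b / x) * (1 / (1 - b / y))"
      if "x > 0" "y > 0" "x \<noteq> y" "x \<noteq> b" "y \<noteq> b" for x y :: real
    proof -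
      have eq: "1 / (1 - x / y) = - y / (x - y)" "1 / (1 - y / x) = x / (x - y)"
        "1 / (1 - b / x) = x / (x - b)" "1 / (1 - b / y) = y / (y - b)"
        using that by (simp_all add: divide_simps) (simp_all add: algebra_simps)
      show ?thesis
        unfolding eq using that by (simp add: divide_simps) (simp add: algebra_simps)
    qed
    have "(\<Sum>i\<in>insert g I. (1 / (\<Prod>j\<in>insert g I-{i}. 1 - a i / a j)) / (1 - b / a i))
      = 1 / (\<Prod>j\<in>I. 1 - a g / a j) / (1 - b / a g)
        + (\<Sum>i\<in>I. (1 / ((1 - a i / a g) * ?P i)) / (1 - b / a i))"
      using insert.hyps by (simp add: 2 1 cong: sum.cong)
    \<comment> \<open>The hypothesis at \<open>a g\<close>, read from right to left, spreads the
      term of the new index over \<open>I\<close>, so that it can be merged with the old terms one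
      by one.\<close>
    also have "1 / (\<Prod>j\<in>I. 1 - a g / a j) = (\<Sum>i\<in>I. (1 / ?P i) / (1 - a g / a i))"
      using IH[of "a g"] pos ne(2) by force
    also have "(\<Sum>i\<in>I. (1 / ?P i) / (1 - a g / a i)) / (1 - b / a g)
        + (\<Sum>i\<in>I. (1 / ((1 - a i / a g) * ?P i)) / (1 - b / a i))
      = (\<Sum>i\<in>I. 1 / ?P i * (1 / (1 - a i / a g) * (1 / (1 - b / a i))
            + 1 / (1 - a g / a i) * (1 / (1 - b / a g))))"
      unfolding sum_divide_distrib sum.distrib[symmetric]
      by (intro sum.cong refl) (simp add: distrib_left mult_ac)
    also have "\<dots> = (\<Sum>i\<in>I. 1 / ?P i * (1 / (1 - b / a i) * (1 / (1 - b / a g))))"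
      using pos ne by (intro sum.cong refl arg_cong2[where f="(*)"] key) auto
    also have "\<dots> = (\<Sum>i\<in>I. (1 / ?P i) / (1 - b / a i)) * (1 / (1 - b / a g))"
      unfolding sum_distrib_right by (intro sum.cong refl) simp
    also have "\<dots> = 1 / (\<Prod>i\<in>insert g I. 1 - b / a i)"
      using insert.hyps IH[of b] insert.prems by simp
    finally show ?thesis by simp
  qed
qed

text \<open>The integrand vanishes outside \<open>{0..t}\<close>; inside, it is an exponential in
  \<open>s\<close> with nonzero rate \<open>b - a\<close>, so it has an elementary antiderivative.
  Being a real integral, the result can be summed with coefficients of either sign.\<close>

lemma has_bochner_integral_exponential_convolution:
  assumes "a > 0" "b > 0" "a \<noteq> b"
  shows "has_bochner_integral lborel
    (\<lambda>s. exponential_density b (t - s) * exponential_density a s)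
    (exponential_density a t / (1 - a / b) + exponential_density b t / (1 - b / a))"
proof (cases "t < 0")
  case True
  then have "(\<lambda>s. exponential_density b (t - s) * exponential_density a s) = (\<lambda>s. 0)"
    by (auto simp: exponential_density_def)
  then show ?thesis using True by (simp add: exponential_density_def has_bochner_integral_zero)
next
  case False
  let ?F = "\<lambda>s. a * b / (b - a) * exp ((b - a) * s - b * t)"
  have "has_bochner_integral lborel
      (\<lambda>s. a * b * exp ((b - a) * s - b * t) * indicator {0..t} s) (?F t - ?F 0)"
    using False assms
    by (intro has_bochner_integral_FTC_Icc_real)
      (auto intro!: derivative_eq_intros continuous_intros simp: divide_simps)
  \<comment> \<open>The closed interval makes the equality exact, since
    \<open>exponential_density\<close> is 0 only at negative arguments.\<close>
  also have "(\<lambda>s. a * b * exp ((b - a) * s - b * t) * indicator {0..t} s)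
      = (\<lambda>s. exponential_density b (t - s) * exponential_density a s)"
    by (auto simp: exponential_density_def fun_eq_iff exp_add[symmetric] algebra_simps
        split: split_indicator)
  also have "?F t - ?F 0
      = exponential_density a t / (1 - a / b) + exponential_density b t / (1 - b / a)"
  proof -
    have 1: "a / (1 - a / b) = a * b / (b - a)" "b / (1 - b / a) = - (a * b / (b - a))"
      using assms by (simp_all add: divide_simps) (simp_all add: algebra_simps)
    have 2: "exponential_density a t / (1 - a / b) = a / (1 - a / b) * exp (- (t * a))"
      "exponential_density b t / (1 - b / a) = b / (1 - b / a) * exp (- (t * b))"
      using False by (simp_all add: exponential_density_def)
    show ?thesis
      unfolding 2 1 by (simp add: algebra_simps)
  qed
  finally show ?thesis .
qed

section \<open>Laws of sums and of logarithms of exponential variables\<close>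

text \<open>Reflection \<open>x \<mapsto> - x\<close> of \<open>nn_integral_FTC_atLeast\<close>; it
  serves to integrate the Gumbel density up to \<open>t\<close>.\<close>

lemma nn_integral_FTC_atMost:
  fixes f F :: "real \<Rightarrow> real"
  assumes f[measurable]: "f \<in> borel_measurable borel"
    and F: "\<And>x. x \<le> a \<Longrightarrow> DERIV F x :> f x"
    and nonneg: "\<And>x. x \<le> a \<Longrightarrow> 0 \<le> f x"
    and lim: "(F \<longlongrightarrow> T) at_bot"
  shows "(\<integral>\<^sup>+x. ennreal (f x) * indicator {..a} x \<partial>lborel) = F a - T"
proof -
  have "(\<integral>\<^sup>+x. ennreal (f x) * indicator {..a} x \<partial>lborel)
      = (\<integral>\<^sup>+x. ennreal (f (- x)) * indicator {..a} (- x) \<partial>lborel)"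
    by (subst nn_integral_real_affine[where c = "-1" and t = 0]) auto
  also have "\<dots> = (\<integral>\<^sup>+x. ennreal (f (- x)) * indicator {- a..} x \<partial>lborel)"
    by (intro nn_integral_cong) (auto split: split_indicator)
  also have "\<dots> = ennreal (- T - (- F (- (- a))))"
  proof (rule nn_integral_FTC_atLeast)
    show "((\<lambda>x. - F (- x)) \<longlongrightarrow> - T) at_top"
      using lim by (intro tendsto_minus) (simp add: filterlim_at_bot_mirror)
    show "DERIV (\<lambda>x. - F (- x)) x :> f (- x)" if "- a \<le> x" for x
      using DERIV_minus[OF DERIV_mirror[THEN iffD1, OF F[of "- x"]]] that by simp
  qed (use nonneg in auto)
  finally show ?thesis by simp
qed

context prob_space
begin

text \<open>Nonnegativity is part of the induction: it cannot be read off a sum whose coefficients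
  may be negative, but it passes to a convolution as the integral of a product of nonnegative
  functions. It also lets the convolution in \<open>ennreal\<close> be computed as a real
  integral.\<close>

lemma hypoexponential_distributed:
  fixes a :: "'i \<Rightarrow> real"
  assumes "finite I" "I \<noteq> {}" "\<And>i. i \<in> I \<Longrightarrow> a i > 0" "inj_on a I"
    and "indep_vars (\<lambda>_. borel) X I"
    and "\<And>i. i \<in> I \<Longrightarrow> distributed M lborel (X i) (exponential_density (a i))"
  defines "h \<equiv> \<lambda>I t. \<Sum>i\<in>I. 1 / (\<Prod>j\<in>I-{i}. 1 - a i / a j) * exponential_density (a i) t"
  shows "distributed M lborel (\<lambda>\<omega>. \<Sum>i\<in>I. X i \<omega>) (h I)" "0 \<le> h I t"
proof -
  have "distributed M lborel (\<lambda>\<omega>. \<Sum>i\<in>I. X i \<omega>) (h I) \<and> (\<forall>t. 0 \<le> h I t)"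
    using assms(1-6)
  proof (induction I rule: finite_ne_induct)
    case (singleton i)
    then show ?case by (simp add: h_def exponential_density_nonneg)
  next
    case (insert g I)
    let ?P = "\<lambda>i. \<Prod>j\<in>I-{i}. 1 - a i / a j"
    let ?e = "\<lambda>i. exponential_density (a i)"
    have pos: "a g > 0" "\<And>i. i \<in> I \<Longrightarrow> a i > 0"
      using insert.prems by auto
    have ne: "\<And>i. i \<in> I \<Longrightarrow> a i \<noteq> a g"
      using insert.prems insert.hyps by (auto simp: inj_on_def)
    have IH: "distributed M lborel (\<lambda>\<omega>. \<Sum>i\<in>I. X i \<omega>) (h I)" "\<And>t. 0 \<le> h I t"
      using insert.IH insert.prems by (auto intro: indep_vars_subset inj_on_subset)
    \<comment> \<open>Each old exponential keeps its coefficient up to the factor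
      \<open>1 / (1 - a i / a g)\<close>, which completes its product. The contributions to the new
      exponential add up to the partial fraction sum at \<open>a g\<close>.\<close>
    have I: "has_bochner_integral lborel (\<lambda>s. ?e g (t - s) * h I s) (h (insert g I) t)" for t
    proof -
      have "has_bochner_integral lborel
          (\<lambda>s. \<Sum>i\<in>I. 1 / ?P i * (?e g (t - s) * ?e i s))
          (\<Sum>i\<in>I. 1 / ?P i * (?e i t / (1 - a i / a g) + ?e g t / (1 - a g / a i)))"
        using pos ne
        by (intro has_bochner_integral_sum has_bochner_integral_mult_right
            has_bochner_integral_exponential_convolution) auto
      also have "(\<lambda>s. \<Sum>i\<in>I. 1 / ?P i * (?e g (t - s) * ?e i s)) = (\<lambda>s. ?e g (t - s) * h I s)"
        by (simp add: h_def sum_distrib_left mult_ac)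
      also have "(\<Sum>i\<in>I. 1 / ?P i * (?e i t / (1 - a i / a g) + ?e g t / (1 - a g / a i)))
        = (\<Sum>i\<in>I. 1 / ((1 - a i / a g) * ?P i) * ?e i t)
          + (\<Sum>i\<in>I. (1 / ?P i) / (1 - a g / a i)) * ?e g t"
        unfolding sum_distrib_right sum.distrib[symmetric]
        by (intro sum.cong refl) (simp add: algebra_simps)
      also have "(\<Sum>i\<in>I. (1 / ?P i) / (1 - a g / a i)) = 1 / (\<Prod>i\<in>I. 1 - a g / a i)"
        using hypoexponential_partial_fraction[of I a "a g"] insert.hyps insert.prems pos ne
        by force
      also have "(\<Sum>i\<in>I. 1 / ((1 - a i / a g) * ?P i) * ?e i t)
          = (\<Sum>i\<in>I. 1 / (\<Prod>j\<in>insert g I - {i}. 1 - a i / a j) * ?e i t)"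
      proof (intro sum.cong refl)
        fix i assume "i \<in> I"
        then have "insert g I - {i} = insert g (I - {i})" using insert.hyps by auto
        then show "1 / ((1 - a i / a g) * ?P i) * ?e i t
            = 1 / (\<Prod>j\<in>insert g I - {i}. 1 - a i / a j) * ?e i t"
          using insert.hyps by simp
      qed
      also have "\<dots> + 1 / (\<Prod>i\<in>I. 1 - a g / a i) * ?e g t = h (insert g I) t"
      proof -
        have "insert g I - {g} = I" using insert.hyps by auto
        then show ?thesis using insert.hyps by (simp add: h_def)
      qed
      finally show ?thesis .
    qed
    have nn: "0 \<le> ?e g s" for s
      using pos by (intro exponential_density_nonneg)
    have "0 \<le> h (insert g I) t" for t
      unfolding has_bochner_integral_integral_eq[OF I[of t], symmetric]
      using nn IH(2) by (intro Bochner_Integration.integral_nonneg) simp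
    moreover have "distributed M lborel (\<lambda>\<omega>. \<Sum>i\<in>insert g I. X i \<omega>) (h (insert g I))"
    proof -
      have "distributed M lborel (\<lambda>\<omega>. X g \<omega> + (\<Sum>i\<in>I. X i \<omega>))
          (\<lambda>t. \<integral>\<^sup>+s. ennreal (?e g (t - s)) * ennreal (h I s) \<partial>lborel)"
        using insert by (intro distributed_convolution indep_vars_sum IH) auto
      also have "(\<lambda>t. \<integral>\<^sup>+s. ennreal (?e g (t - s)) * ennreal (h I s) \<partial>lborel)
          = (\<lambda>t. ennreal (h (insert g I) t))"
      proof
        fix t
        show "(\<integral>\<^sup>+s. ennreal (?e g (t - s)) * ennreal (h I s) \<partial>lborel) = ennreal (h (insert g I) t)"
          using I[of t] nn IH(2)
          by (simp add: ennreal_mult[symmetric] nn_integral_eq_integral has_bochner_integral_iff)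
      qed
      finally show ?thesis using insert.hyps by simp
    qed
    ultimately show ?case by blast
  qed
  then show "distributed M lborel (\<lambda>\<omega>. \<Sum>i\<in>I. X i \<omega>) (h I)" "0 \<le> h I t"
    by blast+
qed

text \<open>The density is not 0 at the origin, so this single point has to be discarded as a null
  set.\<close>

lemma AE_exponential_pos:
  assumes "distributed M lborel X (exponential_density a)"
  shows "AE \<omega> in M. 0 < X \<omega>"
proof -
  have "AE x in lborel. 0 < ennreal (exponential_density a x) \<longrightarrow> 0 < x"
    using AE_lborel_singleton[of 0] by eventually_elim (auto simp: exponential_density_def)
  then show ?thesis by (subst distributed_AE2[OF assms]) auto
qed

text \<open>Both distribution functions equal \<open>1 - exp (- a * exp (t / c))\<close>. The
  location \<open>- c * ln a\<close> is chosen so that the rate \<open>a\<close> is absorbed into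
  the exponent, as \<open>exp ((t + c * ln a) / c)\<close>.\<close>

lemma distributed_ln_exponential_gumbel:
  assumes "a > 0" "c > 0" "distributed M lborel X (exponential_density a)"
  shows "distributed M lborel (\<lambda>\<omega>. c * ln (X \<omega>)) (gumbel_density (- c * ln a) c)"
proof (rule distributedI_borel_atMost)
  have X[measurable]: "X \<in> borel_measurable M"
    using distributed_measurable[OF assms(3)] by simp
  show "random_variable borel (\<lambda>\<omega>. c * ln (X \<omega>))" by measurable
  show "gumbel_density (- c * ln a) c \<in> borel_measurable borel"
    unfolding gumbel_density_def by measurable
  show "AE t in lborel. 0 \<le> gumbel_density (- c * ln a) c t"
    using assms by (simp add: gumbel_density_def)
  fix t
  let ?u = "\<lambda>t. (t - (- c * ln a)) / c"
  have u: "exp (?u t) = exp (t / c) * a"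
    using assms by (simp add: add_divide_distrib exp_add)
  \<comment> \<open>The two events may differ where \<open>X \<omega> \<le> 0\<close>, because
    \<open>ln\<close> is total; that set is null.\<close>
  from AE_exponential_pos[OF assms(3)]
  have "emeasure M {\<omega>\<in>space M. c * ln (X \<omega>) \<le> t} = emeasure M {\<omega>\<in>space M. X \<omega> \<le> exp (t / c)}"
  proof (intro emeasure_eq_AE, goal_cases)
    case 1
    then show ?case
    proof eventually_elim
      case (elim \<omega>)
      have "c * ln (X \<omega>) \<le> t \<longleftrightarrow> ln (X \<omega>) \<le> t / c" using assms by (simp add: field_simps)
      also have "\<dots> \<longleftrightarrow> X \<omega> \<le> exp (t / c)"
        using elim by (metis exp_le_cancel_iff exp_ln)
      finally show ?case by simp
    qed
  qed measurable
  also have "\<dots> = ennreal (1 - exp (- exp (?u t)))"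
    using exponential_distributedD_le[OF assms(3), of "exp (t / c)"] assms(1)
    unfolding u by (simp add: emeasure_eq_measure)
  finally show "emeasure M {\<omega>\<in>space M. c * ln (X \<omega>) \<le> t} = ennreal (1 - exp (- exp (?u t)))" .
  have "(\<integral>\<^sup>+ x. ennreal (gumbel_density (- c * ln a) c x * indicator {..t} x) \<partial>lborel)
      = (\<integral>\<^sup>+ x. ennreal (gumbel_density (- c * ln a) c x) * indicator {..t} x \<partial>lborel)"
    by (intro nn_integral_cong) (simp split: split_indicator)
  also have "\<dots>
    = ennreal (1 - exp (- exp (?u t)))"
  proof -
    let ?F = "\<lambda>t. 1 - exp (- exp (?u t))"
    have "(?F \<longlongrightarrow> 1 - exp (- 0)) at_bot"
    proof (intro tendsto_intros filterlim_compose[OF exp_at_bot])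
      show "filterlim ?u at_bot at_bot"
        using assms by real_asymp
    qed
    moreover have "DERIV ?F x :> gumbel_density (- c * ln a) c x" for x
    proof -
      have "DERIV ?F x :> 1 / c * (exp (?u x) * exp (- exp (?u x)))"
        using assms(2) by (auto intro!: derivative_eq_intros)
      then show ?thesis by (simp add: gumbel_density_def mult_exp_exp)
    qed
    ultimately have "(\<integral>\<^sup>+ x. ennreal (gumbel_density (- c * ln a) c x) * indicator {..t} x \<partial>lborel)
        = ennreal (?F t - (1 - exp (- 0)))"
      using assms
      by (intro nn_integral_FTC_atMost) (auto simp: gumbel_density_def[abs_def])
    then show ?thesis by simp
  qed
  finally show "(\<integral>\<^sup>+ x. ennreal (gumbel_density (- c * ln a) c x * indicator {..t} x) \<partial>lborel)
      = ennreal (1 - exp (- exp (?u t)))" .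
qed

end

section \<open>Real densities and the transformation of their mixtures\<close>

lemma has_pdf_distr:
  assumes "prob_space M" "distributed M lborel X (\<lambda>t. ennreal (f t))" "\<And>t. 0 \<le> f t"
  shows "has_pdf (distr M borel X) f"
proof -
  interpret prob_space M by fact
  have "distr M borel X = distr M lborel X" by (intro distr_cong) auto
  with assms(2,3) show ?thesis
    using distributed_real_measurable[OF _ assms(2)] prob_space_distr[of X borel]
    by (simp add: has_pdf_def distributed_def)
qed

text \<open>Probabilities are expressed by real integrals, which, unlike integrals in
  \<open>ennreal\<close>, can be combined with negative coefficients.\<close>

lemma has_pdf_set_integral:
  assumes "has_pdf N f" "B \<in> sets borel"
  shows "set_integrable lborel B f" "set_lebesgue_integral lborel B f = measure N B"
proof -
  interpret prob_space N using assms(1) unfolding has_pdf_def by blast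
  have N: "N = density lborel f" "f \<in> borel_measurable borel" "AE t in lborel. 0 \<le> f t"
    using assms(1) by (auto simp: has_pdf_def)
  have "sets N = sets borel" by (simp add: N(1))
  then have "integrable N (indicator B :: real \<Rightarrow> real)"
    using assms(2) by (intro integrable_real_indicator) (auto simp: emeasure_eq_measure)
  then show "set_integrable lborel B f"
    using N assms(2) by (simp add: set_integrable_def integrable_real_density mult.commute)
  have "measure N B = integral\<^sup>L N (indicator B)"
    using assms(2) by (simp add: N(1))
  also have "\<dots> = set_lebesgue_integral lborel B f"
    unfolding set_lebesgue_integral_def real_scaleR_def mult.commute[of "indicator B _"]
    by (subst N(1), intro integral_real_density) (use N assms(2) in auto)
  finally show "set_lebesgue_integral lborel B f = measure N B" ..
qed

text \<open>The coefficients may be negative, so the signs of the mixed density have to be recovered from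
  the fact that all its set integrals are probabilities.\<close>

lemma has_pdf_distr_mixture:
  assumes "finite I" and g[measurable]: "g \<in> borel_measurable borel"
    and "\<And>i. i \<in> I \<Longrightarrow> has_pdf (F i) (f i)"
    and "\<And>i. i \<in> I \<Longrightarrow> has_pdf (distr (F i) borel g) (h i)"
    and "has_pdf T (\<lambda>t. \<Sum>i\<in>I. A i * f i t)"
  shows "has_pdf (distr T borel g) (\<lambda>t. \<Sum>i\<in>I. A i * h i t)"
proof -
  let ?h = "\<lambda>t. \<Sum>i\<in>I. A i * h i t"
  have sets: "sets T = sets borel" "\<And>i. i \<in> I \<Longrightarrow> sets (F i) = sets borel"
    using assms(3,5) by (auto simp: has_pdf_def)
  have space: "space T = UNIV" "\<And>i. i \<in> I \<Longrightarrow> space (F i) = UNIV"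
    using sets[THEN sets_eq_imp_space_eq] by auto
  have gT: "g \<in> borel_measurable T" "\<And>i. i \<in> I \<Longrightarrow> g \<in> borel_measurable (F i)"
    using g sets by (simp_all cong: measurable_cong_sets)
  have meas[measurable]: "?h \<in> borel_measurable borel"
    using assms(4) by (intro borel_measurable_sum borel_measurable_times) (auto simp: has_pdf_def)
  interpret D: prob_space "distr T borel g"
    using assms(5) gT by (intro prob_space.prob_space_distr) (auto simp: has_pdf_def)
  \<comment> \<open>Stated for arbitrary laws because it is used on both sides of \<open>g\<close>:
    for the densities \<open>f\<close> on the preimage of \<open>B\<close>, and for the densities
    \<open>h\<close> on \<open>B\<close> itself.\<close>
  have mix: "set_integrable lborel B (\<lambda>t. \<Sum>i\<in>I. A i * u i t)"
      "set_lebesgue_integral lborel B (\<lambda>t. \<Sum>i\<in>I. A i * u i t) = (\<Sum>i\<in>I. A i * measure (G i) B)"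
    if "\<And>i. i \<in> I \<Longrightarrow> has_pdf (G i) (u i)" "B \<in> sets borel" for G u and B :: "real set"
  proof -
    have *: "set_integrable lborel B (\<lambda>t. A i * u i t)"
      "set_lebesgue_integral lborel B (\<lambda>t. A i * u i t) = A i * measure (G i) B" if "i \<in> I" for i
      using has_pdf_set_integral[of "G i" "u i" B] \<open>i \<in> I\<close> that \<open>B \<in> sets borel\<close>
      using \<open>\<And>i. i \<in> I \<Longrightarrow> has_pdf (G i) (u i)\<close> by auto
    then show "set_integrable lborel B (\<lambda>t. \<Sum>i\<in>I. A i * u i t)"
      by (simp add: set_integrable_def sum_distrib_left)
    have "set_lebesgue_integral lborel B (\<lambda>t. \<Sum>i\<in>I. A i * u i t)
        = (\<Sum>i\<in>I. set_lebesgue_integral lborel B (\<lambda>t. A i * u i t))"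
      using *(1) unfolding set_lebesgue_integral_def set_integrable_def scaleR_sum_right
      by (rule Bochner_Integration.integral_sum)
    also have "\<dots> = (\<Sum>i\<in>I. A i * measure (G i) B)"
      using *(2) by (intro sum.cong refl)
    finally show "set_lebesgue_integral lborel B (\<lambda>t. \<Sum>i\<in>I. A i * u i t)
        = (\<Sum>i\<in>I. A i * measure (G i) B)" .
  qed
  have int: "set_lebesgue_integral lborel B ?h = measure (distr T borel g) B"
    if B: "B \<in> sets borel" for B
  proof -
    have B': "g -` B \<in> sets borel" using measurable_sets_borel[OF g B] by simp
    have "set_lebesgue_integral lborel B ?h = (\<Sum>i\<in>I. A i * measure (distr (F i) borel g) B)"
      using mix(2)[of "\<lambda>i. distr (F i) borel g" h B] assms(4) B by simp
    also have "\<dots> = (\<Sum>i\<in>I. A i * measure (F i) (g -` B))"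
      using gT B space by (intro sum.cong refl) (simp add: measure_distr)
    also have "\<dots> = measure T (g -` B)"
      using mix(2)[of F f "g -` B"] assms(3) has_pdf_set_integral(2)[OF assms(5) B'] B' by simp
    also have "\<dots> = measure (distr T borel g) B"
      using gT B space by (simp add: measure_distr)
    finally show ?thesis .
  qed
  have ih: "integrable lborel ?h"
    using mix(1)[of "\<lambda>i. distr (F i) borel g" h UNIV] assms(4) by (simp add: set_integrable_def)
  then have nn: "AE t in lborel. 0 \<le> ?h t"
    by (rule sigma_finite_measure.density_nonneg[OF sigma_finite_lborel]) (simp add: int)
  have "distr T borel g = density lborel (\<lambda>t. ennreal (?h t))"
  proof (rule measure_eqI)
    fix B assume "B \<in> sets (distr T borel g)"
    then have B: "B \<in> sets borel" by simp
    have "emeasure (density lborel (\<lambda>t. ennreal (?h t))) B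
        = (\<integral>\<^sup>+t. ennreal (indicator B t * ?h t) \<partial>lborel)"
      using B by (simp add: emeasure_density)
        (auto intro!: nn_integral_cong split: split_indicator)
    \<comment> \<open>Here \<open>nn\<close> ensures that the coercion to \<open>ennreal\<close>
      truncates only on a null set.\<close>
    also have "\<dots> = ennreal (set_lebesgue_integral lborel B ?h)"
      using nn mix(1)[of "\<lambda>i. distr (F i) borel g" h B] assms(4) B
      unfolding set_lebesgue_integral_def set_integrable_def real_scaleR_def
      by (intro nn_integral_eq_integral) (auto split: split_indicator)
    finally show "emeasure (distr T borel g) B = emeasure (density lborel (\<lambda>t. ennreal (?h t))) B"
      using int[OF B] by (simp add: D.emeasure_eq_measure)
  qed simp
  with meas nn show ?thesis
    unfolding has_pdf_def using D.prob_space_axioms by simp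
qed

lemma mixed_TG_distribution_unique:
  assumes "mixed_TG_distribution I F T S g N"
  shows "N = distr T borel g"
proof -
  obtain A f h where "finite I" "g \<in> borel_measurable borel"
    "\<And>i. i \<in> I \<Longrightarrow> has_pdf (F i) (f i)" "\<And>i. i \<in> I \<Longrightarrow> has_pdf (distr (F i) borel g) (h i)"
    "has_pdf T (\<lambda>t. \<Sum>i\<in>I. A i * f i t)" and N: "has_pdf N (\<lambda>t. \<Sum>i\<in>I. A i * h i t)"
    using assms unfolding mixed_TG_distribution_def by blast
  then have "has_pdf (distr T borel g) (\<lambda>t. \<Sum>i\<in>I. A i * h i t)"
    by (intro has_pdf_distr_mixture)
  with N show ?thesis unfolding has_pdf_def by metis
qed

section \<open>Existence, uniqueness and density of the Gumbel mixture\<close>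

theorem theorem13:
  fixes n :: nat and \<alpha> k :: "nat \<Rightarrow> real" and c lam :: real
    and M :: "'a measure" and X Y :: "nat \<Rightarrow> 'a \<Rightarrow> real"
  assumes "n \<ge> 2"
    and "\<And>i. i \<in> {1..n} \<Longrightarrow> \<alpha> i > 0"
    and "inj_on \<alpha> {1..n}"
    and "c > 0"
    and "prob_space M"
    and "prob_space.indep_vars M (\<lambda>_. borel) X {1..n}"
    and "\<And>i. i \<in> {1..n} \<Longrightarrow> distributed M lborel (X i) (exponential_density (\<alpha> i))"
    and "\<And>i. i \<in> {1..n} \<Longrightarrow> k i = - c * ln (\<alpha> i)"
    and "lam = c"
    and "\<And>i. i \<in> {1..n} \<Longrightarrow> Y i = (\<lambda>\<omega>. c * ln (X i \<omega>))"
  shows "(\<forall>i\<in>{1..n}. distributed M lborel (Y i) (gumbel_density (k i) lam) \<and>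
                     {t. gumbel_density (k i) lam t > 0} = UNIV) \<and>
         (\<exists>!N. mixed_TG_distribution {1..n} (\<lambda>i. distr M borel (X i))
                 (distr M borel (\<lambda>\<omega>. \<Sum>i=1..n. X i \<omega>)) {0<..} (\<lambda>x. c * ln x) N) \<and>
         (\<forall>N. mixed_TG_distribution {1..n} (\<lambda>i. distr M borel (X i))
                 (distr M borel (\<lambda>\<omega>. \<Sum>i=1..n. X i \<omega>)) {0<..} (\<lambda>x. c * ln x) N \<longrightarrow>
               has_pdf N (\<lambda>t. \<Sum>i=1..n. 1 / PG n k lam i * gumbel_density (k i) lam t))"
proof -
  interpret prob_space M by fact
  let ?I = "{1..n}" and ?g = "\<lambda>x. c * ln x"
  let ?F = "\<lambda>i. distr M borel (X i)" and ?T = "distr M borel (\<lambda>\<omega>. \<Sum>i=1..n. X i \<omega>)"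
  let ?A = "\<lambda>i. 1 / PG n k lam i" and ?e = "\<lambda>i. exponential_density (\<alpha> i)"
  let ?G = "\<lambda>i. gumbel_density (k i) lam"
  have PG: "PG n k lam i = (\<Prod>j\<in>?I - {i}. 1 - \<alpha> i / \<alpha> j)" if "i \<in> ?I" for i
    unfolding PG_def
  proof (intro prod.cong refl)
    fix j assume "j \<in> ?I - {i}"
    then have "(- k i + k j) / lam = ln (\<alpha> i / \<alpha> j)" "\<alpha> i / \<alpha> j > 0"
      using assms(2)[of i] assms(2)[of j] that assms(4,8,9) by (simp_all add: ln_div field_simps)
    then show "1 - exp ((- k i + k j) / lam) = 1 - \<alpha> i / \<alpha> j" by simp
  qed
  have Xm: "X i \<in> borel_measurable M" if "i \<in> ?I" for i
    using distributed_measurable[OF assms(7)[OF that]] by simp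
  have gumbel: "distributed M lborel (\<lambda>\<omega>. c * ln (X i \<omega>)) (?G i)" if "i \<in> ?I" for i
    using distributed_ln_exponential_gumbel[of "\<alpha> i" c "X i"] assms that by simp
  have Gpos: "0 < ?G i t" for i t
    using assms(4,9) by (simp add: gumbel_density_def)
  have F: "has_pdf (?F i) (?e i)" if "i \<in> ?I" for i
    using that assms(2,7) prob_space_axioms by (intro has_pdf_distr exponential_density_nonneg) auto
  have gF: "has_pdf (distr (?F i) borel ?g) (?G i)" if "i \<in> ?I" for i
    using has_pdf_distr[OF prob_space_axioms gumbel[OF that] less_imp_le[OF Gpos]] Xm[OF that]
    by (simp add: distr_distr comp_def)
  have T: "has_pdf ?T (\<lambda>t. \<Sum>i\<in>?I. ?A i * ?e i t)"
  proof -
    note * = hypoexponential_distributed[of ?I \<alpha> X, OF _ _ assms(2,3,6,7)]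
    have "has_pdf ?T (\<lambda>t. \<Sum>i\<in>?I. 1 / (\<Prod>j\<in>?I - {i}. 1 - \<alpha> i / \<alpha> j) * ?e i t)"
      using * assms(1) by (intro has_pdf_distr prob_space_axioms) auto
    also have "(\<lambda>t. \<Sum>i\<in>?I. 1 / (\<Prod>j\<in>?I - {i}. 1 - \<alpha> i / \<alpha> j) * ?e i t)
        = (\<lambda>t. \<Sum>i\<in>?I. ?A i * ?e i t)"
      by (intro ext sum.cong refl) (simp only: PG)
    finally show ?thesis .
  qed
  \<comment> \<open>The coefficients found for the hypoexponential density carry over unchanged from
    the exponentials to the Gumbel densities.\<close>
  have gT: "has_pdf (distr ?T borel ?g) (\<lambda>t. \<Sum>i\<in>?I. ?A i * ?G i t)"
    using F gF T by (intro has_pdf_distr_mixture[where f = ?e and F = ?F]) auto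
  have "(\<Sum>i\<in>?I. ?A i) = 1"
  proof -
    have pr: "measure N UNIV = 1" "integrable lborel f" "integral\<^sup>L lborel f = measure N UNIV"
      if "has_pdf N f" for N f
    proof -
      have "space N = UNIV" using that by (simp add: has_pdf_def)
      moreover have "prob_space N" using that unfolding has_pdf_def by blast
      ultimately show "measure N UNIV = 1" using prob_space.prob_space[of N] by simp
      show "integrable lborel f" "integral\<^sup>L lborel f = measure N UNIV"
        using has_pdf_set_integral[OF that, of UNIV]
        by (simp_all add: set_integrable_def set_lebesgue_integral_def)
    qed
    have "1 = (\<integral>t. (\<Sum>i\<in>?I. ?A i * ?e i t) \<partial>lborel)" using pr[OF T] by simp
    also have "\<dots> = (\<Sum>i\<in>?I. \<integral>t. ?A i * ?e i t \<partial>lborel)"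
      using pr(2)[OF F] by (intro Bochner_Integration.integral_sum integrable_mult_right) auto
    also have "\<dots> = (\<Sum>i\<in>?I. ?A i)"
      using pr[OF F] by (intro sum.cong refl) simp
    finally show ?thesis by simp
  qed
  moreover have "AE x in ?F i. x \<in> {0<..}" if "i \<in> ?I" for i
    using AE_exponential_pos[OF assms(7)[OF that]] Xm[OF that] by (simp add: AE_distr_iff)
  moreover have "inj_on ?g {0<..}"
    using assms(4) by (auto simp: inj_on_def)
  \<comment> \<open>The law of \<open>c * ln T\<close> is the witness for existence; by uniqueness
    every other candidate equals it and inherits the density in \<open>gT\<close>.\<close>
  ultimately have ex: "mixed_TG_distribution ?I ?F ?T {0<..} ?g (distr ?T borel ?g)"
    unfolding mixed_TG_distribution_def using F gF T gT
    by (intro conjI exI[of _ ?A] exI[of _ ?e] exI[of _ ?G]) auto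
  show ?thesis
  proof (intro conjI ballI allI impI)
    fix i assume "i \<in> ?I"
    then show "distributed M lborel (Y i) (?G i)" "{t. 0 < ?G i t} = UNIV"
      using gumbel Gpos assms(10) by auto
  next
    show "\<exists>!N. mixed_TG_distribution ?I ?F ?T {0<..} ?g N"
      using ex mixed_TG_distribution_unique by (rule ex1I)
  next
    fix N assume "mixed_TG_distribution ?I ?F ?T {0<..} ?g N"
    from gT[folded mixed_TG_distribution_unique[OF this]]
    show "has_pdf N (\<lambda>t. \<Sum>i\<in>?I. ?A i * ?G i t)" .
  qed
qed

end
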